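(* Consider the deep neural network with $Q$ layers $$[\xi^{(q+1)}(x)]_s=h\big(v_{q,s}^\top\xi^{(q)}(x)\big),\qquad q\in\{1,\dots,Q-1\},\ s\in\{1,\dots,n^{(q+1)}\},$$ where $\xi^{(1)}(x):=[x^\top,1]^\top$ is the input layer, $\xi^{(Q)}(x)$ is the output layer, $n^{(q)}\in\mathbb N$ is the dimension of the $q$th layer, $v_{q,s}\in\mathbb R^{n^{(q)}}$ are weight vectors and $h$ is the activation function. Suppose that $h\in\mathcal H(y)$ for every continuous function $y:\widetilde{\mathbb X}\to\mathbb R$. For any $Q$ and any dimensions $n^{(q)}$ such that $T\ge n^{(q)}$ for every $q\in\{1,\dots,Q-1\}$, each component of the output $\xi^{(Q)}$ belongs to $\mathcal F(Q)$.
   Context: Simplexes. Let $n\in\mathbb N=\{1,2,\dots\}$, let $\mathbb X\subset\mathbb R^n$ be a bounded closed set containing the origin, and let $\widetilde{\mathbb X}\subset\mathbb R^n$ be a bounded open set containing $\mathbb X$. A simplex collection $\mathcal S=(\mathbb X_i)_{i\in\mathcal I}$ consists of a finite set $\mathcal I\subset\mathbb N$ and, for each $i\in\mathcal I$, vertices $x_{i,1},\dots,x_{i,n+1}\in\mathbb X$ such that $x_{i,j}-x_{i,n+1}$, $j=1,\dots,n$, are linearly independent; with $x_i(w):=\sum_{j=1}^{n+1}w_jx_{i,j}$ and $\mathbb X_i:=\{x_i(w): w_j\ge 0\ \forall j,\ \sum_{j=1}^{n+1}w_j=1\}$, it is required that $\mathbb X=\bigcup_{i\in\mathcal I}\mathbb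 X_i$. For continuous $\xi:\widetilde{\mathbb X}\to\mathbb R$, the linear interpolation $\xi^{\mathrm I}:\mathbb X\to\mathbb R$ with respect to $\mathcal S$ is given by $\xi^{\mathrm I}(x_i(w)):=\sum_{j}w_j\xi(x_{i,j})$ for all $i$ and all $x_i(w)\in\mathbb X_i$ (simplex collections are understood to fit together so that this is well defined). Function classes. Let $T\in\mathbb N$ be a predefined number. "Known" means that the object in question can be identified from the form of the function and given information. For continuous $y:\widetilde{\mathbb X}\to\mathbb R$, $\mathcal H(y)$ is the set of functions $h:\widetilde{\mathbb Y}\to\mathbb R$ such that: (H1) $\widetilde{\mathbb Y}\subseteq\mathbb R$ is an open set containing $\{y(x):x\in\widetilde{\mathbb X}\}$; (H2) $h$ is $C^2$, there are known constants (not depending on $\mathcal S$) with $\underline{\partial}(h)\le h'(\tilde y)\le\overline{\partial}(h)$ for all $\tilde y\in\mathbb Y:=\{y(x):x\in\mathbb X\}$, and for some $C_h>0$, for every simplex collection $\mathcal S$ there are known constants with $\underline{\partial^2}(h)\le h''(\tilde y)\le\overline{\partial^2}(h)$ for all $\tilde y\in\mathbb Y^{\mathrm I}:=\{y^{\mathrm I}(x):x\in\mathbb X\}$ and $|\underline{\partial^2}(h)|+|\overline{\partial^2}(h)|<C_h$. $\mathcal F(1)$ is the set of $C^2$ functions $\xi:\widetilde{\mathbb X}\to\mathbb R$ for which there are known constants with $\underline{d^2}(\xi)\le \frac{\partial^2}{\partial\chi^2}\xi(x+\chi\nu)\big|_{\chi=0}\le\overline{d^2}(\xi)$ for all $x\in\mathbb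 X$ and all $\nu\in\mathbb R^n$ with $\|\nu\|=1$. For $N\ge2$, $\mathcal F(N)$ is the set of functions $\Phi:\widetilde{\mathbb X}\to\mathbb R$ for which there are known $\phi_s,\psi_s\in\mathcal F(N-1)$, $s=1,\dots,T$, and $h\in\mathcal H(y)$ with $\Phi(x)=h(y(x))$, $y(x)=\sum_{s=1}^T\phi_s(x)\psi_s(x)$. *)

theory Defs
  imports "HOL-Analysis.Analysis"
begin

text \<open>
  Real coordinate space of dimension n is \<open>real ^ 'n\<close> with n = \<open>CARD('n)\<close>; indices run from 1, and
  only the values at the stated indices are relevant. A function on an open domain is a total
  function of which only the values on that domain are constrained.
\<close>

definition C2_on :: "'a::real_normed_vector set \<Rightarrow> ('a \<Rightarrow> real) \<Rightarrow> bool" where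
  "C2_on S f \<longleftrightarrow>
     (\<exists>(f' :: 'a \<Rightarrow> 'a \<Rightarrow>\<^sub>L real) (f'' :: 'a \<Rightarrow> 'a \<Rightarrow>\<^sub>L 'a \<Rightarrow>\<^sub>L real).
        (\<forall>x\<in>S. (f has_derivative blinfun_apply (f' x)) (at x)) \<and>
        (\<forall>x\<in>S. (f' has_derivative blinfun_apply (f'' x)) (at x)) \<and>
        continuous_on S f'')"

subsection \<open>Simplex collections and linear interpolation\<close>

definition weights :: "nat \<Rightarrow> (nat \<Rightarrow> real) set" where
  "weights n = {w. (\<forall>j\<in>{1..n+1}. 0 \<le> w j) \<and> (\<Sum>j=1..n+1. w j) = 1}"

definition simplex_point :: "(nat \<Rightarrow> nat \<Rightarrow> real ^ 'n) \<Rightarrow> nat \<Rightarrow> (nat \<Rightarrow> real) \<Rightarrow> real ^ 'n" where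
  "simplex_point V i w = (\<Sum>j=1..CARD('n)+1. w j *\<^sub>R V i j)"

definition simplex_of :: "(nat \<Rightarrow> nat \<Rightarrow> real ^ 'n) \<Rightarrow> nat \<Rightarrow> (real ^ 'n) set" where
  "simplex_of V i = simplex_point V i ` weights CARD('n)"

definition vertex_mean ::
    "(nat \<Rightarrow> nat \<Rightarrow> real ^ 'n) \<Rightarrow> (real ^ 'n \<Rightarrow> real) \<Rightarrow> nat \<Rightarrow> (nat \<Rightarrow> real) \<Rightarrow> real" where
  "vertex_mean V \<xi> i w = (\<Sum>j=1..CARD('n)+1. w j * \<xi> (V i j))"

text \<open>
  The last condition says that the simplexes fit together: the linear interpolation of every
  continuous function is well defined.
\<close>

definition simplex_collection ::
    "(real ^ 'n) set \<Rightarrow> (real ^ 'n) set \<Rightarrow> nat set \<Rightarrow> (nat \<Rightarrow> nat \<Rightarrow> real ^ 'n) \<Rightarrow> bool" where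
  "simplex_collection X Xt I V \<longleftrightarrow>
     finite I \<and> 0 \<notin> I \<and>
     (\<forall>i\<in>I. \<forall>j\<in>{1..CARD('n)+1}. V i j \<in> X) \<and>
     (\<forall>i\<in>I. inj_on (\<lambda>j. V i j - V i (CARD('n)+1)) {1..CARD('n)} \<and>
            independent ((\<lambda>j. V i j - V i (CARD('n)+1)) ` {1..CARD('n)})) \<and>
     X = (\<Union>i\<in>I. simplex_of V i) \<and>
     (\<forall>\<xi>. continuous_on Xt \<xi> \<longrightarrow>
        (\<forall>i\<in>I. \<forall>i'\<in>I. \<forall>w\<in>weights CARD('n). \<forall>w'\<in>weights CARD('n).
           simplex_point V i w = simplex_point V i' w' \<longrightarrow>
           vertex_mean V \<xi> i w = vertex_mean V \<xi> i' w'))"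

definition interpolation ::
    "nat set \<Rightarrow> (nat \<Rightarrow> nat \<Rightarrow> real ^ 'n) \<Rightarrow> (real ^ 'n \<Rightarrow> real) \<Rightarrow> real ^ 'n \<Rightarrow> real" where
  "interpolation I V \<xi> x =
     (THE r. \<exists>i\<in>I. \<exists>w\<in>weights CARD('n). x = simplex_point V i w \<and> r = vertex_mean V \<xi> i w)"

subsection \<open>Known objects\<close>

text \<open>
  Being known (identifiable from the form of a function and the given information) is not a
  property of the object alone, so it is kept abstract: a state of knowledge is a set of known
  numbers, of known functions on \<open>Xt\<close>, and of known univariate functions paired with their domain.
  All that is required is that explicitly written objects built from known ones are known. Taking
  every object as known is allowed (lemma \<open>knowledge_UNIV\<close>), and then ``there is a known ...'' is
  just ``there is ...''.
\<close>

record 'a knowledge =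
  known_numbers :: "real set"
  known_functions :: "('a \<Rightarrow> real) set"
  known_univariate :: "(real set \<times> (real \<Rightarrow> real)) set"

definition knowledge_on :: "(real ^ 'n) set \<Rightarrow> (real ^ 'n) knowledge \<Rightarrow> bool" where
  "knowledge_on Xt K \<longleftrightarrow>
     0 \<in> known_numbers K \<and> 1 \<in> known_numbers K \<and>
     (\<forall>c\<in>known_numbers K. (\<lambda>x. c) \<in> known_functions K) \<and>
     (\<forall>k. (\<lambda>x. x $ k) \<in> known_functions K) \<and>
     (\<forall>f\<in>known_functions K. \<forall>g\<in>known_functions K.
        (\<lambda>x. f x + g x) \<in> known_functions K \<and> (\<lambda>x. f x * g x) \<in> known_functions K) \<and>
     (UNIV, \<lambda>t. t) \<in> known_univariate K \<and>
     (\<forall>(Yt, h)\<in>known_univariate K. \<forall>f\<in>known_functions K.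
        f ` Xt \<subseteq> Yt \<longrightarrow> (\<lambda>x. h (f x)) \<in> known_functions K)"

lemma knowledge_UNIV:
  "knowledge_on Xt \<lparr>known_numbers = UNIV, known_functions = UNIV, known_univariate = UNIV\<rparr>"
  by (simp add: knowledge_on_def)

subsection \<open>Function classes\<close>

text \<open>
  An element of \<open>class_H K X Xt y\<close> is a function \<open>h\<close> together with its domain \<open>Yt\<close>. The inclusion
  of the range of the interpolation in \<open>Yt\<close> is what makes the bounds on the second derivative
  meaningful.
\<close>

definition class_H ::
    "(real ^ 'n) knowledge \<Rightarrow> (real ^ 'n) set \<Rightarrow> (real ^ 'n) set \<Rightarrow> (real ^ 'n \<Rightarrow> real) \<Rightarrow>
     (real set \<times> (real \<Rightarrow> real)) set" where
  "class_H K X Xt y =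
     {(Yt, h).
        open Yt \<and> y ` Xt \<subseteq> Yt \<and>
        C2_on Yt h \<and>
        (\<exists>l\<in>known_numbers K. \<exists>u\<in>known_numbers K.
           \<forall>t\<in>y ` X. l \<le> deriv h t \<and> deriv h t \<le> u) \<and>
        (\<exists>C>0. \<forall>I V. simplex_collection X Xt I V \<longrightarrow>
           interpolation I V y ` X \<subseteq> Yt \<and>
           (\<exists>l\<in>known_numbers K. \<exists>u\<in>known_numbers K.
              (\<forall>t\<in>interpolation I V y ` X. l \<le> deriv (deriv h) t \<and> deriv (deriv h) t \<le> u) \<and>
              \<bar>l\<bar> + \<bar>u\<bar> < C))}"

text \<open>The classes are indexed from 1; the value at 0 is a dummy.\<close>

fun class_F ::
    "(real ^ 'n) knowledge \<Rightarrow> (real ^ 'n) set \<Rightarrow> (real ^ 'n) set \<Rightarrow> nat \<Rightarrow> nat \<Rightarrow>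
     (real ^ 'n \<Rightarrow> real) set" where
  "class_F K X Xt T 0 = {}"
| "class_F K X Xt T (Suc 0) =
     {\<xi>. C2_on Xt \<xi> \<and>
        (\<exists>l\<in>known_numbers K. \<exists>u\<in>known_numbers K.
           \<forall>x\<in>X. \<forall>\<nu>. norm \<nu> = 1 \<longrightarrow>
             l \<le> deriv (deriv (\<lambda>r. \<xi> (x + r *\<^sub>R \<nu>))) 0 \<and>
             deriv (deriv (\<lambda>r. \<xi> (x + r *\<^sub>R \<nu>))) 0 \<le> u)}"
| "class_F K X Xt T (Suc (Suc N)) =
     {\<Phi>. \<exists>\<phi> \<psi> Yt h.
        (\<forall>s\<in>{1..T}. \<phi> s \<in> known_functions K \<inter> class_F K X Xt T (Suc N) \<and>
                     \<psi> s \<in> known_functions K \<inter> class_F K X Xt T (Suc N)) \<and>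
        (Yt, h) \<in> known_univariate K \<inter> class_H K X Xt (\<lambda>x. \<Sum>s=1..T. \<phi> s x * \<psi> s x) \<and>
        (\<forall>x\<in>Xt. \<Phi> x = h (\<Sum>s=1..T. \<phi> s x * \<psi> s x))}"

subsection \<open>The network\<close>

text \<open>
  Component \<open>s\<close> of layer \<open>q\<close> at \<open>x\<close>, for layer widths \<open>d\<close> and weight vectors \<open>v q s\<close>. The bijection
  \<open>e\<close> from \<open>{1..CARD('n)}\<close> to \<open>'n\<close> numbers the coordinates of \<open>x\<close>. Layers are counted from 1; the
  value at 0 is a dummy.
\<close>

fun layer ::
    "(nat \<Rightarrow> 'n) \<Rightarrow> (real \<Rightarrow> real) \<Rightarrow> (nat \<Rightarrow> nat) \<Rightarrow> (nat \<Rightarrow> nat \<Rightarrow> nat \<Rightarrow> real) \<Rightarrow>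
     nat \<Rightarrow> real ^ 'n \<Rightarrow> nat \<Rightarrow> real" where
  "layer e h d v 0 x s = 0"
| "layer e h d v (Suc 0) x s = (if s \<le> CARD('n) then x $ e s else 1)"
| "layer e h d v (Suc (Suc q)) x s =
     h (\<Sum>j=1..d (Suc q). v (Suc q) s j * layer e h d v (Suc q) x j)"

end

theory Submission
  imports Defs
begin

text \<open>
  A neuron \<open>h (\<Sum>j. v\<^sub>j \<xi>\<^sub>j(x))\<close> already has the shape required of a member of the next class, with
  the previous layer as one family of factors and the weights, read as constant functions, as the
  other. The one obstacle is that both families must lie in the class of the previous layer: a known
  constant has to be a member of \<open>\<F>(N)\<close> for every \<open>N\<close>, and these classes are not obviously
  nested. Here the identity serves as an auxiliary activation function: it belongs to \<open>\<H>(y)\<close> for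
  every \<open>y\<close>, its derivatives being \<open>1\<close> and \<open>0\<close>, so that \<open>\<F>(N + 1)\<close> contains every sum of \<open>T\<close>
  products of known members of \<open>\<F>(N)\<close>, among them \<open>c \<cdot> 1 + 0 \<cdot> 0 + \<dots> + 0 \<cdot> 0 = c\<close>
  (\<open>constant_in_class_F\<close>).

  The zero function is then available in every class to pad a layer of width below \<open>T\<close> to exactly
  \<open>T\<close> summands (\<open>composed_weighted_sum_in_class_F\<close>), and the theorem follows by induction on the
  layer. The induction carries along that the components are known and that they are continuous on
  \<open>Xt\<close>: the hypothesis on the activation function speaks only of continuous arguments, and the
  continuity of a new layer comes in turn from that hypothesis, which makes \<open>h\<close> a \<open>C\<^sup>2\<close> function on
  a set containing the range of its argument.
\<close>

lemma C2_on_affine: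
  fixes f :: "'a::real_normed_vector \<Rightarrow> real"
  assumes "bounded_linear f"
  shows "C2_on S (\<lambda>x. f x + c)"
proof -
  have "((\<lambda>x. f x + c) has_derivative blinfun_apply (Blinfun f)) (at x)" for x
    using assms by (simp add: bounded_linear_Blinfun_apply has_derivative_add_const
        bounded_linear_imp_has_derivative)
  moreover have "((\<lambda>_::'a. Blinfun f) has_derivative blinfun_apply (0 :: 'a \<Rightarrow>\<^sub>L 'a \<Rightarrow>\<^sub>L real)) (at x)" for x
    by (simp add: zero_blinfun.rep_eq)
  ultimately show ?thesis
    unfolding C2_on_def by (intro exI[of _ "\<lambda>_. Blinfun f"] exI[of _ "\<lambda>_. 0"]) auto
qed

lemma C2_on_imp_continuous_on:
  assumes "C2_on S f"
  shows "continuous_on S f"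
  using assms unfolding C2_on_def
  by (auto intro!: continuous_at_imp_continuous_on dest: has_derivative_continuous)

lemma knowledge_onD:
  assumes "knowledge_on Xt K"
  shows zero_known: "0 \<in> known_numbers K"
    and one_known: "1 \<in> known_numbers K"
    and constant_known: "c \<in> known_numbers K \<Longrightarrow> (\<lambda>x. c) \<in> known_functions K"
    and coordinate_known: "(\<lambda>x. x $ k) \<in> known_functions K"
    and add_known: "f \<in> known_functions K \<Longrightarrow> g \<in> known_functions K \<Longrightarrow>
      (\<lambda>x. f x + g x) \<in> known_functions K"
    and mult_known: "f \<in> known_functions K \<Longrightarrow> g \<in> known_functions K \<Longrightarrow>
      (\<lambda>x. f x * g x) \<in> known_functions K"
    and identity_known: "(UNIV, \<lambda>t. t) \<in> known_univariate K"
    and compose_known: "(Yt, h) \<in> known_univariate K \<Longrightarrow> f \<in> known_functions K \<Longrightarrow>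
      f ` Xt \<subseteq> Yt \<Longrightarrow> (\<lambda>x. h (f x)) \<in> known_functions K"
  using assms unfolding knowledge_on_def by blast+

lemma sum_known:
  assumes K: "knowledge_on Xt K"
    and "finite A" and "\<And>j. j \<in> A \<Longrightarrow> f j \<in> known_functions K"
  shows "(\<lambda>x. \<Sum>j\<in>A. f j x) \<in> known_functions K"
  using assms(2,3)
  by (induction A rule: finite_induct)
    (simp_all add: constant_known[OF K zero_known[OF K]] add_known[OF K])

lemma identity_in_class_H:
  assumes "knowledge_on Xt K"
  shows "(UNIV, \<lambda>t. t) \<in> class_H K X Xt y"
proof -
  have "C2_on UNIV (\<lambda>t::real. t)"
    using C2_on_affine[OF bounded_linear_ident, of UNIV 0] by simp
  moreover have "\<exists>C>0::real. \<bar>0\<bar> + \<bar>0\<bar> < C"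
    by (intro exI[of _ 1]) simp
  ultimately show ?thesis
    using zero_known[OF assms] one_known[OF assms] unfolding class_H_def by fastforce
qed

text \<open>Affine functions cover the coordinates as well as the constants of the input layer.\<close>

lemma affine_in_class_F_1:
  fixes f :: "real ^ 'n \<Rightarrow> real"
  assumes K: "knowledge_on Xt K" and f: "bounded_linear f"
  shows "(\<lambda>x. f x + c) \<in> class_F K X Xt T (Suc 0)"
proof -
  interpret bounded_linear f by (fact f)
  have "((\<lambda>r. f (x + r *\<^sub>R \<nu>) + c) has_real_derivative f \<nu>) (at r)" for x \<nu> r
    unfolding add scale by (auto intro!: derivative_eq_intros)
  then have "deriv (\<lambda>r. f (x + r *\<^sub>R \<nu>) + c) = (\<lambda>_. f \<nu>)" for x \<nu>
    by (intro ext DERIV_imp_deriv)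
  then show ?thesis
    using C2_on_affine[OF f, of Xt c] zero_known[OF K] by auto
qed

text \<open>
  Multiplying by the constant one and applying the identity lifts a constant from one class to the
  next. The products other than the first are \<open>0 \<cdot> 0\<close>, and \<open>1 \<le> T\<close> leaves room for the first.
\<close>

lemma constant_in_class_F:
  assumes K: "knowledge_on Xt K" and "1 \<le> T" and "c \<in> known_numbers K"
  shows "(\<lambda>x. c) \<in> class_F K X Xt T (Suc N)"
  using \<open>c \<in> known_numbers K\<close>
proof (induction N arbitrary: c)
  case 0
  show ?case
    using affine_in_class_F_1[OF K bounded_linear_zero, of c] by simp
next
  case (Suc N)
  let ?\<phi> = "\<lambda>s::nat. \<lambda>_::real^'b. if s = 1 then c else 0"
  let ?\<psi> = "\<lambda>s::nat. \<lambda>_::real^'b. if s = 1 then 1 else (0::real)"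
  have const: "(\<lambda>x. a) \<in> known_functions K \<inter> class_F K X Xt T (Suc N)"
    if "a \<in> known_numbers K" for a
    using constant_known[OF K that] Suc.IH[OF that] by blast
  have "\<forall>s\<in>{1..T}. ?\<phi> s \<in> known_functions K \<inter> class_F K X Xt T (Suc N) \<and>
                    ?\<psi> s \<in> known_functions K \<inter> class_F K X Xt T (Suc N)"
    using const[OF Suc.prems] const[OF zero_known[OF K]] const[OF one_known[OF K]] by simp
  moreover have "(\<Sum>s=1..T. ?\<phi> s x * ?\<psi> s x) = c" for x
    using \<open>1 \<le> T\<close> by (simp add: if_distrib cong: if_cong)
  ultimately show ?case
    using identity_known[OF K] identity_in_class_H[OF K]
    unfolding class_F.simps mem_Collect_eq
    by (intro exI[of _ ?\<phi>] exI[of _ ?\<psi>] exI[of _ UNIV] exI[of _ "\<lambda>t. t"]) simp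
qed

text \<open>
  The class asks for exactly \<open>T\<close> products of functions of the preceding class. The weights enter as
  constant functions, and both families of factors are extended by zero beyond \<open>m\<close>.
\<close>

lemma composed_weighted_sum_in_class_F:
  assumes K: "knowledge_on Xt K" and "1 \<le> T" and "m \<le> T"
    and w: "\<And>j. j \<in> {1..m} \<Longrightarrow> w j \<in> known_numbers K"
    and g: "\<And>j. j \<in> {1..m} \<Longrightarrow> g j \<in> known_functions K \<inter> class_F K X Xt T (Suc N)"
    and h: "(Yt, h) \<in> known_univariate K \<inter> class_H K X Xt (\<lambda>x. \<Sum>j=1..m. w j * g j x)"
  shows "(\<lambda>x. h (\<Sum>j=1..m. w j * g j x)) \<in> class_F K X Xt T (Suc (Suc N))"
proof -
  let ?\<phi> = "\<lambda>s x. if s \<le> m then w s else 0"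
  let ?\<psi> = "\<lambda>s. if s \<le> m then g s else (\<lambda>x. 0)"
  have const: "(\<lambda>x. a) \<in> known_functions K \<inter> class_F K X Xt T (Suc N)"
    if "a \<in> known_numbers K" for a
    using constant_known[OF K that] constant_in_class_F[OF K \<open>1 \<le> T\<close> that] by blast
  have factors: "\<forall>s\<in>{1..T}. ?\<phi> s \<in> known_functions K \<inter> class_F K X Xt T (Suc N) \<and>
                    ?\<psi> s \<in> known_functions K \<inter> class_F K X Xt T (Suc N)"
    using g const[OF w] const[OF zero_known[OF K]] by simp
  have pad: "(\<Sum>s=1..T. ?\<phi> s x * ?\<psi> s x) = (\<Sum>j=1..m. w j * g j x)" for x
    using \<open>m \<le> T\<close> by (intro sum.mono_neutral_cong_right) auto
  show ?thesis
    unfolding class_F.simps mem_Collect_eq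
    by (intro exI[of _ ?\<phi>] exI[of _ ?\<psi>] exI[of _ Yt] exI[of _ h], unfold pad)
      (use factors h in simp)
qed

theorem theorem6:
  fixes X Xt :: "(real ^ 'n) set"
    and K :: "(real ^ 'n) knowledge"
    and T Q :: nat
    and d :: "nat \<Rightarrow> nat"
    and v :: "nat \<Rightarrow> nat \<Rightarrow> nat \<Rightarrow> real"
    and Yt :: "real set"
    and h :: "real \<Rightarrow> real"
    and e :: "nat \<Rightarrow> 'n"
  assumes "closed X" and "bounded X" and "0 \<in> X"
    and "open Xt" and "bounded Xt" and "X \<subseteq> Xt"
    and "T \<ge> 1"
    and "knowledge_on Xt K"
    and "bij_betw e {1..CARD('n)} UNIV"
    and "Q \<ge> 1"
    and "d 1 = CARD('n) + 1" and "\<And>q. q \<in> {1..Q} \<Longrightarrow> d q \<ge> 1"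
    and "\<And>q. q \<in> {1..Q - 1} \<Longrightarrow> d q \<le> T"
    and "(Yt, h) \<in> known_univariate K"
    and "\<And>q s j. q \<in> {1..Q - 1} \<Longrightarrow> s \<in> {1..d (q + 1)} \<Longrightarrow> j \<in> {1..d q} \<Longrightarrow>
           v q s j \<in> known_numbers K"
    and "\<And>y. continuous_on Xt y \<Longrightarrow> (Yt, h) \<in> class_H K X Xt y"
  shows "\<forall>s\<in>{1..d Q}. (\<lambda>x. layer e h d v Q x s) \<in> class_F K X Xt T Q"
proof -
  note K = \<open>knowledge_on Xt K\<close>
  let ?f = "\<lambda>q s x. layer e h d v q x s"
  have "?f (Suc q) s \<in> known_functions K \<inter> class_F K X Xt T (Suc q) \<and> continuous_on Xt (?f (Suc q) s)"
    if "Suc q \<le> Q" "s \<in> {1..d (Suc q)}" for q s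
    using that
  proof (induction q arbitrary: s)
    case 0
    show ?case
    proof (cases "s \<le> CARD('n)")
      case True
      then show ?thesis
        using coordinate_known[OF K, of "e s"]
          affine_in_class_F_1[OF K bounded_linear_vec_nth, of "e s" 0]
        by (simp add: continuous_on_component)
    next
      case False
      then show ?thesis
        using constant_known[OF K one_known[OF K]] constant_in_class_F[OF K \<open>T \<ge> 1\<close> one_known[OF K], of X 0]
        by simp
    qed
  next
    case (Suc q)
    let ?m = "d (Suc q)"
    let ?w = "v (Suc q) s"
    let ?y = "\<lambda>x. \<Sum>j=1..?m. ?w j * ?f (Suc q) j x"
    have IH: "?f (Suc q) j \<in> known_functions K \<inter> class_F K X Xt T (Suc q)"
      "continuous_on Xt (?f (Suc q) j)" if "j \<in> {1..?m}" for j
      using Suc.IH[of j] Suc.prems that by auto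
    have "Suc q \<in> {1..Q - 1}"
      using Suc.prems by simp
    then have m: "?m \<le> T" and w: "\<And>j. j \<in> {1..?m} \<Longrightarrow> ?w j \<in> known_numbers K"
      using assms(13)[of "Suc q"] assms(15)[of "Suc q" s] Suc.prems(2) by auto
    have y_cont: "continuous_on Xt ?y"
      using IH(2) by (intro continuous_intros) auto
    have h: "(Yt, h) \<in> class_H K X Xt ?y"
      using assms(16)[OF y_cont] .
    then have range: "?y ` Xt \<subseteq> Yt" and h_cont: "continuous_on Yt h"
      unfolding class_H_def using C2_on_imp_continuous_on by auto
    have "?y \<in> known_functions K"
      using IH(1) constant_known[OF K w]
      by (intro sum_known[OF K]) (auto intro!: mult_known[OF K])
    then have "?f (Suc (Suc q)) s \<in> known_functions K"
      using compose_known[OF K \<open>(Yt, h) \<in> known_univariate K\<close> _ range] by simp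
    moreover have "?f (Suc (Suc q)) s \<in> class_F K X Xt T (Suc (Suc q))"
      using composed_weighted_sum_in_class_F[OF K \<open>T \<ge> 1\<close> m w IH(1), where Yt = Yt and h = h]
        h \<open>(Yt, h) \<in> known_univariate K\<close> by (simp del: class_F.simps)
    moreover have "continuous_on Xt (?f (Suc (Suc q)) s)"
      using continuous_on_compose2[OF h_cont y_cont range] by simp
    ultimately show ?case
      by blast
  qed
  from this[of "Q - 1"] show ?thesis
    using \<open>Q \<ge> 1\<close> by simp
qed

end
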